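(* Let $n$ be a positive integer with $n \leq 6$. Then the following three statements hold. (1) An $n \times n$ integer matrix $M$ is the crossing matrix $C(b)$ of some positive pure $n$-braid diagram $b$ if and only if $M$ is a non-negative integer T0 symmetric matrix. (2) An $n \times n$ non-negative integer matrix $M$ is the OU matrix $U(b)$ of some pure $n$-braid diagram $b$ if and only if $M+M^T$ is an even T0 matrix. (3) An $n \times n$ non-negative integer matrix $M$ is the CN matrix $N(B)$ of some pure $n$-braid projection $B$ if and only if $M$ is an even T0 symmetric matrix.
   Context: Braid projections and diagrams. An $n$-braid projection $B$ consists of $n$ strands in the plane, each running monotonically downward from one of $n$ points on an upper horizontal bar to one of $n$ points on a lower horizontal bar, meeting each other only in finitely many transverse double points (crossings). The strands are named $s_1,\dots,s_n$ from left to right at the top. Combinatorially, $B$ is encoded by a finite word $k_1k_2\cdots k_r$ with letters in $\{1,\dots,n-1\}$: reading from top to bottom, the letter $k$ means that the two strands currently in positions $k$ and $k+1$ cross once and exchange positions. No reduction is assumed. An $n$-braid diagram $b$ is an $n$-braid projection together with over/under information at each crossing. A projection or diagram is pure if each strand $s_i$ ends at the $i$-th position (from the left) at the bottom. Signs. A crossing of a diagram is positive if the strand going from upper left to lower right passes under the strand going from upper right to lower left; otherwise it is negative. A diagram is positive if all its crossings are positive. Matrices. All of the following are $n\times n$ matrices with zero diagonal; for $i \ne j$ the $(i,j)$ entries are as follows. - Crossing matrix $C(b)$: the number of positive crossings minus the number of negative crossings between $s_i$ and $s_j$ at which $s_i$ is over $s_j$. - OU matrix $U(b)$: the number of crossings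 between $s_i$ and $s_j$ at which $s_i$ is over $s_j$. - CN matrix $N(B)$: the number of crossings between $s_i$ and $s_j$. An $n\times n$ matrix $M$ is T0 if its diagonal is zero and, whenever $1\le i<j<k\le n$, $M(i,j)=M(j,k)=0$ implies $M(i,k)=0$. A matrix is even if every entry is an even integer. $M^T$ is the transpose of $M$. *)

theory Defs
  imports "Jordan_Normal_Form.Matrix" "HOL-Combinatorics.Transposition"
begin

section \<open>Braid projections\<close>

text \<open>
  Strands and positions are numbered from 1, from left to right; strand \<open>i\<close> is the one that
  starts at position \<open>i\<close> of the upper bar. A projection is its word of letters, read from top to
  bottom: the letter \<open>k\<close> crosses the strands currently in positions \<open>k\<close> and \<open>k + 1\<close>.
\<close>

definition braid_projection :: "nat \<Rightarrow> nat list \<Rightarrow> bool" where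
  "braid_projection n w \<longleftrightarrow> set w \<subseteq> {1..<n}"

text \<open>\<open>strand_at w p\<close> is the strand in position \<open>p\<close> below all the crossings of \<open>w\<close>.\<close>

definition strand_at :: "nat list \<Rightarrow> nat \<Rightarrow> nat" where
  "strand_at w = fold (\<lambda>k \<sigma>. \<sigma> \<circ> Transposition.transpose k (Suc k)) w id"

definition pure_projection :: "nat \<Rightarrow> nat list \<Rightarrow> bool" where
  "pure_projection n w \<longleftrightarrow> braid_projection n w \<and> (\<forall>i\<in>{1..n}. strand_at w i = i)"

text \<open>
  Crossings are referred to by their index \<open>t < length w\<close> in the word. The left strand of a
  crossing is the one going from upper left to lower right, the right strand the one going from
  upper right to lower left.
\<close>

definition left_strand :: "nat list \<Rightarrow> nat \<Rightarrow> nat" where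
  "left_strand w t = strand_at (take t w) (w ! t)"

definition right_strand :: "nat list \<Rightarrow> nat \<Rightarrow> nat" where
  "right_strand w t = strand_at (take t w) (Suc (w ! t))"

definition crossings_between :: "nat list \<Rightarrow> nat \<Rightarrow> nat \<Rightarrow> nat set" where
  "crossings_between w i j = {t. t < length w \<and> {left_strand w t, right_strand w t} = {i, j}}"

section \<open>Braid diagrams\<close>

datatype over_info = Left_Over | Right_Over

type_synonym diagram = "(nat \<times> over_info) list"

definition proj :: "diagram \<Rightarrow> nat list" where
  "proj b = map fst b"

definition braid_diagram :: "nat \<Rightarrow> diagram \<Rightarrow> bool" where
  "braid_diagram n b \<longleftrightarrow> braid_projection n (proj b)"

definition pure_diagram :: "nat \<Rightarrow> diagram \<Rightarrow> bool" where
  "pure_diagram n b \<longleftrightarrow> braid_diagram n b \<and> pure_projection n (proj b)"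

definition over_strand :: "diagram \<Rightarrow> nat \<Rightarrow> nat" where
  "over_strand b t = (case snd (b ! t) of
      Left_Over \<Rightarrow> left_strand (proj b) t
    | Right_Over \<Rightarrow> right_strand (proj b) t)"

text \<open>A crossing is positive iff its left strand passes under its right strand.\<close>

definition positive_crossing :: "diagram \<Rightarrow> nat \<Rightarrow> bool" where
  "positive_crossing b t \<longleftrightarrow> snd (b ! t) = Right_Over"

definition positive_diagram :: "diagram \<Rightarrow> bool" where
  "positive_diagram b \<longleftrightarrow> (\<forall>t < length b. positive_crossing b t)"

definition over_crossings :: "diagram \<Rightarrow> nat \<Rightarrow> nat \<Rightarrow> nat set" where
  "over_crossings b i j = {t \<in> crossings_between (proj b) i j. over_strand b t = i}"

section \<open>Matrices of diagrams and projections\<close>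

text \<open>
  Matrix indices start at 0, so the entry at index \<open>(i, j)\<close> is the one of strands \<open>i + 1\<close> and
  \<open>j + 1\<close>.
\<close>

definition crossing_matrix :: "nat \<Rightarrow> diagram \<Rightarrow> int mat" where
  "crossing_matrix n b = mat n n (\<lambda>(i, j). if i = j then 0 else
      int (card {t \<in> over_crossings b (Suc i) (Suc j). positive_crossing b t})
    - int (card {t \<in> over_crossings b (Suc i) (Suc j). \<not> positive_crossing b t}))"

definition OU_matrix :: "nat \<Rightarrow> diagram \<Rightarrow> int mat" where
  "OU_matrix n b = mat n n (\<lambda>(i, j). if i = j then 0 else
      int (card (over_crossings b (Suc i) (Suc j))))"

definition CN_matrix :: "nat \<Rightarrow> nat list \<Rightarrow> int mat" where
  "CN_matrix n w = mat n n (\<lambda>(i, j). if i = j then 0 else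
      int (card (crossings_between w (Suc i) (Suc j))))"

section \<open>Properties of integer matrices\<close>

definition T0_mat :: "int mat \<Rightarrow> bool" where
  "T0_mat M \<longleftrightarrow> square_mat M \<and> (\<forall>i < dim_row M. M $$ (i, i) = 0) \<and>
     (\<forall>i j k. i < j \<longrightarrow> j < k \<longrightarrow> k < dim_row M \<longrightarrow>
        M $$ (i, j) = 0 \<longrightarrow> M $$ (j, k) = 0 \<longrightarrow> M $$ (i, k) = 0)"

definition even_mat :: "int mat \<Rightarrow> bool" where
  "even_mat M \<longleftrightarrow> (\<forall>x \<in> elements_mat M. even x)"

definition nonneg_int_mat :: "int mat \<Rightarrow> bool" where
  "nonneg_int_mat M \<longleftrightarrow> (\<forall>x \<in> elements_mat M. 0 \<le> x)"

definition sym_mat :: "int mat \<Rightarrow> bool" where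
  "sym_mat M \<longleftrightarrow> transpose_mat M = M"

end

(*
  Entries of the CN matrix of a pure projection are even, because two strands that start and end in
  the same order cross equally often in both directions, and T0, because strands that do not cross
  keep their order, so that s_j separates s_i from s_k. For the converse, a set E of pairs of
  strands is reduced as long as it is not empty: concatenating words realizes a disjoint union of
  two T0 sets, and conjugating a word by the letter k adds two crossings of s_k and s_(k+1) and
  swaps the roles of these two strands in all other pairs. For at most 6 strands one of the two
  reductions always applies, which is a propositional tautology in the 15 pairs. Parts (1) and (2)
  follow from part (3) by a choice of over/under information.
*)
theory Submission
  imports Defs
begin

section \<open>Counting crossings\<close>

abbreviation (input) adj_swap :: "nat \<Rightarrow> nat \<Rightarrow> nat" where
  "adj_swap k \<equiv> Transposition.transpose k (Suc k)"

section \<open>Adjacent transpositions and the permutation of a word\<close>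

lemma adj_swap_less_iff:
  assumes "i \<noteq> j"
  shows "adj_swap k i < adj_swap k j \<longleftrightarrow> (if {i, j} = {k, Suc k} then j < i else i < j)"
  using assms by (auto simp: Transposition.transpose_def doubleton_eq_iff)

lemma adj_swap_eq_iff [simp]: "adj_swap k i = adj_swap k j \<longleftrightarrow> i = j"
  by (metis transpose_involutory)

lemma strand_at_Nil [simp]: "strand_at [] = id"
  by (simp add: strand_at_def)

text \<open>Letters permute positions, the arguments of \<open>strand_at\<close>, so lower letters
  are composed on the inside: \<open>strand_at v\<close> carries a position below \<open>v\<close>
  to the position below \<open>u\<close> from which its strand comes.\<close>

lemma strand_at_append: "strand_at (u @ v) = strand_at u \<circ> strand_at v"
proof -
  have "fold (\<lambda>k \<sigma>. \<sigma> \<circ> adj_swap k) v \<tau> = \<tau> \<circ> fold (\<lambda>k \<sigma>. \<sigma> \<circ> adj_swap k) v id"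
    for \<tau> :: "nat \<Rightarrow> nat"
  proof (induction v arbitrary: \<tau>)
    case (Cons k v)
    show ?case
      using Cons[of "\<tau> \<circ> adj_swap k"] Cons[of "adj_swap k"] by (simp add: comp_assoc)
  qed simp
  from this[of "strand_at u"] show ?thesis
    by (simp add: strand_at_def)
qed

lemma strand_at_single [simp]: "strand_at [k] = adj_swap k"
  by (simp add: strand_at_def)

lemma strand_at_Cons: "strand_at (k # v) = adj_swap k \<circ> strand_at v"
  using strand_at_append[of "[k]" v] by simp

lemma bij_strand_at: "bij (strand_at w)"
proof (induction w)
  case (Cons k w)
  then show ?case
    unfolding strand_at_Cons by (rule bij_comp) simp
qed (simp add: bij_def)

lemma strand_at_eq_iff [simp]: "strand_at w p = strand_at w q \<longleftrightarrow> p = q"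
  using bij_strand_at[of w] by (auto simp: bij_def inj_def)

text \<open>Refines \<open>crossings_between\<close> by direction: the first strand comes from the
  upper left. Direction drives the parity argument and decides which strand is over in a positive
  diagram.\<close>

definition left_right_crossings :: "nat list \<Rightarrow> nat \<Rightarrow> nat \<Rightarrow> nat set" where
  "left_right_crossings w i j = {t. t < length w \<and> left_strand w t = i \<and> right_strand w t = j}"

lemma finite_left_right_crossings [simp]: "finite (left_right_crossings w i j)"
  by (simp add: left_right_crossings_def)

lemma finite_crossings_between [simp]: "finite (crossings_between w i j)"
  by (simp add: crossings_between_def)

lemma crossings_between_commute: "crossings_between w i j = crossings_between w j i"
  by (simp add: crossings_between_def insert_commute)

lemma card_crossings_between:
  assumes "i \<noteq> j"
  shows "card (crossings_between w i j) =
    card (left_right_crossings w i j) + card (left_right_crossings w j i)"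
proof -
  have "crossings_between w i j = left_right_crossings w i j \<union> left_right_crossings w j i"
    by (auto simp: crossings_between_def left_right_crossings_def doubleton_eq_iff)
  moreover have "left_right_crossings w i j \<inter> left_right_crossings w j i = {}"
    using assms by (auto simp: left_right_crossings_def)
  ultimately show ?thesis
    by (simp add: card_Un_disjoint)
qed

text \<open>The strand that \<open>v\<close> on its own calls \<open>i\<close> is
  \<open>strand_at u i\<close> in \<open>u @ v\<close>. Under this renaming the crossings of
  \<open>v\<close> reappear with indices shifted by \<open>length u\<close>.\<close>

lemma card_left_right_crossings_append:
  "card (left_right_crossings (u @ v) (strand_at u i) (strand_at u j)) =
    card (left_right_crossings u (strand_at u i) (strand_at u j)) + card (left_right_crossings v i j)"
proof -
  have "left_right_crossings (u @ v) (strand_at u i) (strand_at u j) =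
      left_right_crossings u (strand_at u i) (strand_at u j) \<union>
      (+) (length u) ` left_right_crossings v i j" (is "?A = ?B \<union> ?C")
  proof (rule Set.set_eqI)
    fix t
    show "t \<in> ?A \<longleftrightarrow> t \<in> ?B \<union> ?C"
    proof (cases "t < length u")
      case True
      then show ?thesis
        by (auto simp: left_right_crossings_def left_strand_def right_strand_def nth_append)
    next
      case False
      then obtain s where "t = length u + s"
        using le_Suc_ex not_less by blast
      then show ?thesis
        by (auto simp: left_right_crossings_def left_strand_def right_strand_def nth_append
            strand_at_append)
    qed
  qed
  moreover have "?B \<inter> ?C = {}"
    by (auto simp: left_right_crossings_def)
  ultimately show ?thesis
    by (simp add: card_Un_disjoint card_image)
qed

lemma card_left_right_crossings_single:
  "card (left_right_crossings [k] i j) = of_bool (i = k \<and> j = Suc k)"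
proof -
  have "left_right_crossings [k] i j = (if i = k \<and> j = Suc k then {0} else {})"
    by (auto simp: left_right_crossings_def left_strand_def right_strand_def)
  then show ?thesis
    by simp
qed

lemma left_right_crossings_Nil [simp]: "left_right_crossings [] i j = {}"
  by (simp add: left_right_crossings_def)

text \<open>A telescoping sum: each crossing of the two strands switches the truth value of "the
  first is left of the second", with sign given by its direction. The value is read from the names
  at the top and from the positions at the bottom.\<close>

lemma left_right_crossings_diff:
  assumes "p \<noteq> q"
  shows "int (card (left_right_crossings w (strand_at w p) (strand_at w q)))
      - int (card (left_right_crossings w (strand_at w q) (strand_at w p)))
    = of_bool (strand_at w p < strand_at w q) - of_bool (p < q)"
  using assms
proof (induction w arbitrary: p q rule: rev_induct)
  case (snoc k u)
  let ?p = "adj_swap k p" and ?q = "adj_swap k q"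
  have "?p \<noteq> ?q"
    using snoc.prems by simp
  note IH = snoc.IH[OF this]
  have "of_bool (?p = k \<and> ?q = Suc k) - of_bool (?q = k \<and> ?p = Suc k)
      = (of_bool (?p < ?q) - of_bool (p < q) :: int)"
    using snoc.prems
    by (cases "p = k"; cases "q = k"; cases "p = Suc k"; cases "q = Suc k")
      (auto simp: Transposition.transpose_def)
  with IH show ?case
    using card_left_right_crossings_append[of u "[k]" ?p ?q]
      card_left_right_crossings_append[of u "[k]" ?q ?p]
    by (simp add: card_left_right_crossings_single strand_at_append)
qed simp

text \<open>In a pure projection the orders at top and bottom agree, so the telescoped difference
  vanishes.\<close>

lemma pure_left_right_crossings_commute:
  assumes "pure_projection n w" "i \<in> {1..n}" "j \<in> {1..n}"
  shows "card (left_right_crossings w i j) = card (left_right_crossings w j i)"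
proof (cases "i = j")
  case False
  then show ?thesis
    using left_right_crossings_diff[of i j w] assms by (simp add: pure_projection_def)
qed simp

text \<open>Strands that have not crossed keep their order, so the middle strand always separates
  the outer two. Naming strands by their final positions lets the induction remove the last
  letter.\<close>

lemma crossings_between_T0:
  assumes "strand_at w p < strand_at w q" "strand_at w q < strand_at w r"
    and "crossings_between w (strand_at w p) (strand_at w q) = {}"
    and "crossings_between w (strand_at w q) (strand_at w r) = {}"
  shows "crossings_between w (strand_at w p) (strand_at w r) = {}"
  using assms
proof (induction w arbitrary: p q r rule: rev_induct)
  case (snoc k u)
  let ?s = "strand_at u" and ?p = "adj_swap k p" and ?q = "adj_swap k q" and ?r = "adj_swap k r"
  have split: "crossings_between (u @ [k]) (?s x) (?s y) = {} \<longleftrightarrow>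
      crossings_between u (?s x) (?s y) = {} \<and> {x, y} \<noteq> {k, Suc k}" if "x \<noteq> y" for x y
  proof -
    have "crossings_between (u @ [k]) (?s x) (?s y) = {} \<longleftrightarrow>
        card (crossings_between (u @ [k]) (?s x) (?s y)) = 0"
      by simp
    also have "\<dots> \<longleftrightarrow> card (crossings_between u (?s x) (?s y)) = 0 \<and> {x, y} \<noteq> {k, Suc k}"
      using that card_left_right_crossings_append[of u "[k]" x y]
        card_left_right_crossings_append[of u "[k]" y x]
      by (auto simp: card_crossings_between card_left_right_crossings_single doubleton_eq_iff
          simp del: card_0_eq)
    finally show ?thesis
      by simp
  qed
  have order: "x < y" if "?s x < ?s y" "crossings_between u (?s x) (?s y) = {}" for x y
  proof -
    have "x \<noteq> y"
      using that by auto
    moreover have "card (left_right_crossings u (?s x) (?s y)) = 0"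
      "card (left_right_crossings u (?s y) (?s x)) = 0"
      using that \<open>x \<noteq> y\<close> card_crossings_between[of "?s x" "?s y" u] by auto
    ultimately show ?thesis
      using left_right_crossings_diff[of x y u] that by (simp split: if_splits)
  qed
  have s: "?s ?p < ?s ?q" "?s ?q < ?s ?r"
    using snoc.prems by (simp_all add: strand_at_append)
  then have neq: "?p \<noteq> ?q" "?q \<noteq> ?r" "?p \<noteq> ?r"
    by auto
  have "crossings_between u (?s ?p) (?s ?q) = {}" "crossings_between u (?s ?q) (?s ?r) = {}"
    using snoc.prems split neq by (simp_all add: strand_at_append)
  moreover from this have "?p < ?q" "?q < ?r"
    using order s by blast+
  \<comment> \<open>Position \<open>?q\<close> lies strictly between the two, so they are not
    adjacent and the last letter cannot cross them.\<close>
  moreover from this have "{?p, ?r} \<noteq> {k, Suc k}"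
    by (auto simp: doubleton_eq_iff)
  ultimately show ?case
    using snoc.IH[of ?p ?q ?r] s split neq by (simp add: strand_at_append)
qed (simp add: crossings_between_def)

section \<open>Realizable crossing numbers\<close>

definition strand_pairs :: "nat \<Rightarrow> (nat \<times> nat) set" where
  "strand_pairs n = {(i, j). 1 \<le> i \<and> i < j \<and> j \<le> n}"

definition realizable :: "nat \<Rightarrow> (nat \<Rightarrow> nat \<Rightarrow> nat) \<Rightarrow> bool" where
  "realizable n m \<longleftrightarrow> (\<exists>w. pure_projection n w \<and>
     (\<forall>i j. (i, j) \<in> strand_pairs n \<longrightarrow> card (crossings_between w i j) = m i j))"

text \<open>Only increasing pairs are constrained, so functions built by relabelling or case
  distinction can be exchanged as soon as they agree there.\<close>

lemma realizable_cong:
  assumes "\<And>i j. (i, j) \<in> strand_pairs n \<Longrightarrow> m i j = m' i j"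
  shows "realizable n m \<longleftrightarrow> realizable n m'"
proof -
  have "(\<forall>i j. (i, j) \<in> strand_pairs n \<longrightarrow> card (crossings_between w i j) = m i j) \<longleftrightarrow>
      (\<forall>i j. (i, j) \<in> strand_pairs n \<longrightarrow> card (crossings_between w i j) = m' i j)" for w
    using assms by auto
  then show ?thesis
    by (simp add: realizable_def)
qed

lemma realizable_zero: "realizable n (\<lambda>i j. 0)"
  unfolding realizable_def
  by (rule exI[of _ "[]"])
    (simp add: pure_projection_def braid_projection_def crossings_between_def)

lemma realizable_add:
  assumes "realizable n m" "realizable n m'"
  shows "realizable n (\<lambda>i j. m i j + m' i j)"
proof -
  obtain u v where u: "pure_projection n u"
      "\<And>i j. (i, j) \<in> strand_pairs n \<Longrightarrow> card (crossings_between u i j) = m i j"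
    and v: "pure_projection n v"
      "\<And>i j. (i, j) \<in> strand_pairs n \<Longrightarrow> card (crossings_between v i j) = m' i j"
    using assms unfolding realizable_def by blast
  have "pure_projection n (u @ v)"
    using u v by (simp add: pure_projection_def braid_projection_def strand_at_append)
  moreover have "card (crossings_between (u @ v) i j) = m i j + m' i j"
    if "(i, j) \<in> strand_pairs n" for i j
  proof -
    have "strand_at u i = i" "strand_at u j = j" "i \<noteq> j"
      using u that by (auto simp: pure_projection_def strand_pairs_def)
    then have "card (crossings_between (u @ v) i j) =
        card (crossings_between u i j) + card (crossings_between v i j)"
      using card_left_right_crossings_append[of u v i j]
        card_left_right_crossings_append[of u v j i]
      by (simp add: card_crossings_between)
    then show ?thesis
      using u v that by auto
  qed
  ultimately show ?thesis
    unfolding realizable_def by blast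
qed

text \<open>Realized by the word \<open>k v k\<close>: between the two letters, strands
  \<open>k\<close> and \<open>Suc k\<close> have exchanged places. Their own pair needs a separate
  case because the swap makes it a decreasing pair.\<close>

lemma realizable_conjugate:
  assumes "realizable n m" "(k, Suc k) \<in> strand_pairs n"
  shows "realizable n (\<lambda>i j. if i = k \<and> j = Suc k then m k (Suc k) + 2
    else m (adj_swap k i) (adj_swap k j))"
proof -
  obtain v where v: "pure_projection n v"
      "\<And>i j. (i, j) \<in> strand_pairs n \<Longrightarrow> card (crossings_between v i j) = m i j"
    using assms unfolding realizable_def by blast
  let ?w = "[k] @ v @ [k]"
  have k: "1 \<le> k" "Suc k \<le> n"
    using assms by (auto simp: strand_pairs_def)
  have fix_swap: "strand_at v (adj_swap k i) = adj_swap k i" if "i \<in> {1..n}" for i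
    using v that k by (auto simp: pure_projection_def Transposition.transpose_def)
  have "pure_projection n ?w"
    using v k fix_swap
    by (auto simp: pure_projection_def braid_projection_def strand_at_append strand_at_Cons)
  moreover have "card (crossings_between ?w i j) =
      (if i = k \<and> j = Suc k then m k (Suc k) + 2 else m (adj_swap k i) (adj_swap k j))"
    if ij: "(i, j) \<in> strand_pairs n" for i j
  proof -
    let ?i = "adj_swap k i" and ?j = "adj_swap k j"
    \<comment> \<open>The three summands come from the first letter, from \<open>v\<close> and from
      the last letter, which crosses \<open>k\<close> and \<open>Suc k\<close> in the opposite
      direction.\<close>
    have lr: "card (left_right_crossings ?w x y) = of_bool (x = k \<and> y = Suc k)
        + card (left_right_crossings v (adj_swap k x) (adj_swap k y))
        + of_bool (x = Suc k \<and> y = k)" if "x \<in> {1..n}" "y \<in> {1..n}" for x y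
    proof -
      have "card (left_right_crossings ?w x y) = of_bool (x = k \<and> y = Suc k)
          + card (left_right_crossings (v @ [k]) (adj_swap k x) (adj_swap k y))"
        using card_left_right_crossings_append[of "[k]" "v @ [k]" "adj_swap k x" "adj_swap k y"]
        by (simp add: card_left_right_crossings_single)
      also have "card (left_right_crossings (v @ [k]) (adj_swap k x) (adj_swap k y)) =
          card (left_right_crossings v (adj_swap k x) (adj_swap k y))
          + of_bool (x = Suc k \<and> y = k)"
        using card_left_right_crossings_append[of v "[k]" "adj_swap k x" "adj_swap k y"] that
        by (auto simp: fix_swap card_left_right_crossings_single transpose_eq_iff)
      finally show ?thesis
        by simp
    qed
    have ij': "i \<in> {1..n}" "j \<in> {1..n}" "i < j" "?i \<noteq> ?j"
      using ij by (auto simp: strand_pairs_def)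
    then have card_w: "card (crossings_between ?w i j) =
        2 * of_bool (i = k \<and> j = Suc k) + card (crossings_between v ?i ?j)"
      unfolding card_crossings_between[OF ij'(4)] card_crossings_between[OF less_imp_neq[OF ij'(3)]]
        lr[OF ij'(1,2)] lr[OF ij'(2,1)]
      by auto
    show ?thesis
    proof (cases "i = k \<and> j = Suc k")
      case True
      then have "card (crossings_between v ?i ?j) = m k (Suc k)"
        using v(2)[OF assms(2)] by (simp add: crossings_between_commute[of v "Suc k" k])
      then show ?thesis
        using card_w True by simp
    next
      case False
      then have "(?i, ?j) \<in> strand_pairs n"
        using ij k by (auto simp: strand_pairs_def Transposition.transpose_def)
      then show ?thesis
        using card_w False v by auto
    qed
  qed
  ultimately show ?thesis
    unfolding realizable_def by blast
qed

text \<open>Realized by \<open>c\<close> copies of the word \<open>k k\<close>, which is the empty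
  word conjugated by \<open>k\<close>.\<close>

lemma realizable_adjacent:
  assumes "(k, Suc k) \<in> strand_pairs n"
  shows "realizable n (\<lambda>i j. if i = k \<and> j = Suc k then 2 * c else 0)"
proof (induction c)
  case 0
  show ?case
    by (simp add: realizable_zero cong: if_cong)
next
  case (Suc c)
  have "realizable n (\<lambda>i j. if i = k \<and> j = Suc k then 2 else 0)"
    using realizable_conjugate[OF realizable_zero assms] by (simp add: numeral_2_eq_2 cong: if_cong)
  from realizable_add[OF this Suc] show ?case
    by (rule realizable_cong[THEN iffD1, rotated]) simp
qed

section \<open>T0 sets of strand pairs\<close>

text \<open>The T0 condition in contrapositive form, for the set of pairs with non-zero entry.
  Equivalently, the increasing pairs outside \<open>E\<close> form a transitive relation.\<close>

definition T0_set :: "(nat \<times> nat) set \<Rightarrow> bool" where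
  "T0_set E \<longleftrightarrow> (\<forall>i j k. i < j \<longrightarrow> j < k \<longrightarrow> (i, k) \<in> E \<longrightarrow> (i, j) \<in> E \<or> (j, k) \<in> E)"

text \<open>
  Adding the reversed pair \<open>(k + 1, k)\<close> to the partial order of the pairs outside of \<open>E\<close> keeps it
  transitive.
\<close>

definition swappable :: "(nat \<times> nat) set \<Rightarrow> nat \<Rightarrow> bool" where
  "swappable E k \<longleftrightarrow> (k, Suc k) \<in> E
     \<and> (\<forall>x<k. (x, k) \<in> E \<longrightarrow> (x, Suc k) \<in> E)
     \<and> (\<forall>y>Suc k. (Suc k, y) \<in> E \<longrightarrow> (k, y) \<in> E)"

text \<open>The support that remains to be realized inside a conjugation by \<open>k\<close>: the
  pair \<open>(k, Suc k)\<close> is dropped and the two names are exchanged.\<close>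

definition swap_pairs :: "(nat \<times> nat) set \<Rightarrow> nat \<Rightarrow> (nat \<times> nat) set" where
  "swap_pairs E k = {(i, j). i < j \<and> (adj_swap k i, adj_swap k j) \<in> E - {(k, Suc k)}}"

lemma swap_pairs_subset:
  assumes "E \<subseteq> strand_pairs n" "swappable E k"
  shows "swap_pairs E k \<subseteq> strand_pairs n"
proof (rule subrelI)
  fix i j
  assume ij: "(i, j) \<in> swap_pairs E k"
  have "(k, Suc k) \<in> strand_pairs n"
    using assms by (auto simp: swappable_def)
  moreover have "(adj_swap k i, adj_swap k j) \<in> strand_pairs n" "i < j"
    using ij assms(1) by (auto simp: swap_pairs_def)
  ultimately show "(i, j) \<in> strand_pairs n"
    by (auto simp: strand_pairs_def Transposition.transpose_def split: if_splits)
qed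

text \<open>If the swap keeps the order of \<open>i < j < l\<close>, the T0 property of
  \<open>E\<close> applies. Otherwise it inverts two neighbours of the triple, and each of these two
  cases is covered by one implication in \<open>swappable\<close>.\<close>

lemma T0_set_swap_pairs:
  assumes "T0_set E" "swappable E k"
  shows "T0_set (swap_pairs E k)"
  unfolding T0_set_def
proof (intro allI impI)
  fix i j l :: nat
  assume less: "i < j" "j < l" and il: "(i, l) \<in> swap_pairs E k"
  let ?s = "adj_swap k"
  have il': "(?s i, ?s l) \<in> E"
    using il by (simp add: swap_pairs_def)
  consider "i = k" "j = Suc k" | "j = k" "l = Suc k" | "?s i < ?s j" "?s j < ?s l"
    using less adj_swap_less_iff[of i j k] adj_swap_less_iff[of j l k]
    by (auto simp: doubleton_eq_iff split: if_splits)
  then show "(i, j) \<in> swap_pairs E k \<or> (j, l) \<in> swap_pairs E k"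
  proof cases
    case 1
    then have "(Suc k, l) \<in> E"
      using il' less by (simp add: Transposition.transpose_def)
    then show ?thesis
      using 1 less assms(2) by (simp add: swappable_def swap_pairs_def Transposition.transpose_def)
  next
    case 2
    then have "(i, k) \<in> E"
      using il' less by (simp add: Transposition.transpose_def)
    then show ?thesis
      using 2 less assms(2) by (simp add: swappable_def swap_pairs_def Transposition.transpose_def)
  next
    case 3
    then have "(?s i, ?s j) \<in> E \<or> (?s j, ?s l) \<in> E"
      using assms(1) il' unfolding T0_set_def by blast
    \<comment> \<open>The dropped pair has only a decreasing preimage, so dropping it loses nothing
      here.\<close>
    moreover have "(?s x, ?s y) \<noteq> (k, Suc k)" if "x < y" for x y
      using that by (auto simp: Transposition.transpose_def split: if_splits)
    ultimately show ?thesis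
      using less by (auto simp: swap_pairs_def)
  qed
qed

lemma finite_strand_pairs: "finite (strand_pairs n)"
  by (rule finite_subset[of _ "{..n} \<times> {..n}"]) (auto simp: strand_pairs_def)

text \<open>The renaming is injective and misses \<open>(k, Suc k)\<close>, which lies in
  \<open>E\<close>; this makes the main induction terminate.\<close>

lemma card_swap_pairs:
  assumes "finite E" "swappable E k"
  shows "card (swap_pairs E k) < card E"
proof -
  let ?f = "map_prod (adj_swap k) (adj_swap k)"
  have "card (swap_pairs E k) \<le> card (E - {(k, Suc k)})"
  proof (rule card_inj_on_le)
    show "inj_on ?f (swap_pairs E k)"
      by (auto simp: inj_on_def)
    show "?f ` swap_pairs E k \<subseteq> E - {(k, Suc k)}"
      by (auto simp: swap_pairs_def)
  qed (use assms in simp)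
  also have "\<dots> < card E"
    using assms by (intro psubset_card_mono) (auto simp: swappable_def)
  finally show ?thesis .
qed

text \<open>
  Found by a greedy computer search for sets that split, for 6 strands, all T0 sets without
  a swappable index.
\<close>

definition split_sets :: "(nat \<times> nat) set set" where
  "split_sets =
    {{(1, 3), (1, 5), (2, 3), (2, 5), (2, 6), (4, 5), (4, 6)},
     {(1, 2), (1, 4), (1, 5), (3, 4), (3, 5), (3, 6), (4, 5)},
     {(2, 3), (2, 4), (3, 4)},
     {(1, 5), (2, 5), (3, 5), (4, 5), (4, 6)},
     {(2, 3), (2, 4), (2, 5), (3, 4), (3, 5), (4, 5)},
     {(1, 2), (1, 3), (1, 5), (4, 5)},
     {(1, 2), (1, 3), (1, 4), (1, 5), (2, 3), (2, 4), (2, 5)},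
     {(1, 2), (1, 3), (1, 4), (1, 5), (1, 6), (2, 4), (2, 5), (3, 4), (3, 5), (3, 6)},
     {(2, 5), (3, 4), (3, 5), (4, 5)},
     {(1, 2), (1, 3), (1, 4)},
     {(3, 4)}}"

section \<open>Finite case check for six strands\<close>

lemma strand_pairs_6:
  "strand_pairs 6 = {(1, 2), (1, 3), (1, 4), (1, 5), (1, 6), (2, 3), (2, 4), (2, 5), (2, 6),
    (3, 4), (3, 5), (3, 6), (4, 5), (4, 6), (5, 6)}"
proof -
  have "strand_pairs 6 = Set.filter (\<lambda>(i, j). i < j) ({1..6} \<times> {1..6})"
    by (auto simp: strand_pairs_def)
  also have "\<dots> = {(1, 2), (1, 3), (1, 4), (1, 5), (1, 6), (2, 3), (2, 4), (2, 5), (2, 6),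
    (3, 4), (3, 5), (3, 6), (4, 5), (4, 6), (5, 6)}"
    by code_simp
  finally show ?thesis .
qed

text \<open>All quantifiers now range over explicit finite sets, so simplification yields a
  propositional formula in the 15 membership atoms.\<close>

lemma T0_set_6_iff:
  assumes "E \<subseteq> strand_pairs 6"
  shows "T0_set E \<longleftrightarrow> (\<forall>(i, k) \<in> strand_pairs 6. \<forall>j \<in> {1, 2, 3, 4, 5, 6}.
    i < j \<longrightarrow> j < k \<longrightarrow> (i, k) \<in> E \<longrightarrow> (i, j) \<in> E \<or> (j, k) \<in> E)"
proof -
  have "j \<in> {1, 2, 3, 4, 5, 6}" if "(i, k) \<in> strand_pairs 6" "i < j" "j < k" for i j k
    using that by (auto simp: strand_pairs_def)
  then show ?thesis
    using assms unfolding T0_set_def by blast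
qed

lemma swappable_6_iff:
  assumes "E \<subseteq> strand_pairs 6"
  shows "swappable E k \<longleftrightarrow> (k, Suc k) \<in> E
    \<and> (\<forall>x \<in> {1, 2, 3, 4, 5, 6}. x < k \<longrightarrow> (x, k) \<in> E \<longrightarrow> (x, Suc k) \<in> E)
    \<and> (\<forall>y \<in> {1, 2, 3, 4, 5, 6}. y > Suc k \<longrightarrow> (Suc k, y) \<in> E \<longrightarrow> (k, y) \<in> E)"
proof -
  have "i \<in> {1, 2, 3, 4, 5, 6} \<and> j \<in> {1, 2, 3, 4, 5, 6}" if "(i, j) \<in> E" for i j
    using that assms by (auto simp: strand_pairs_def)
  then show ?thesis
    unfolding swappable_def by blast
qed

text \<open>A propositional tautology, checked by refuting its negation. Both parts of a split are
  required to be non-empty so that each is smaller than \<open>E\<close>.\<close>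

lemma T0_set_6_cases:
  assumes "E \<subseteq> strand_pairs 6" "T0_set E" "E \<noteq> {}"
  shows "(\<exists>k \<in> {1, 2, 3, 4, 5}. swappable E k) \<or>
    (\<exists>A \<in> split_sets. E \<inter> A \<noteq> {} \<and> E - A \<noteq> {} \<and> T0_set (E \<inter> A) \<and> T0_set (E - A))"
proof -
  have sub: "E \<inter> A \<subseteq> strand_pairs 6" "E - A \<subseteq> strand_pairs 6" for A
    using assms(1) by auto
  have empty_6_iff: "F = {} \<longleftrightarrow> (\<forall>p \<in> strand_pairs 6. p \<notin> F)" if "F \<subseteq> strand_pairs 6" for F
    using that by auto
  show ?thesis
  proof (rule ccontr)
    assume *: "\<not> ?thesis"
    \<comment> \<open>\<open>1\<close> and \<open>Suc 0\<close> would give different atoms for the SAT solver\<close>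
    note [simp del] = One_nat_def
    note iffs = T0_set_6_iff[OF sub(1)] T0_set_6_iff[OF sub(2)] T0_set_6_iff[OF assms(1)]
      empty_6_iff[OF sub(1)] empty_6_iff[OF sub(2)] empty_6_iff[OF assms(1)]
      swappable_6_iff[OF assms(1)] strand_pairs_6
    have "\<forall>A \<in> split_sets. E \<inter> A = {} \<or> E - A = {} \<or> \<not> T0_set (E \<inter> A) \<or> \<not> T0_set (E - A)"
      using * by blast
    note splits = this[unfolded split_sets_def iffs, simplified]
    have "\<forall>k \<in> {1, 2, 3, 4, 5}. \<not> swappable E k"
      using * by blast
    note swaps = this[unfolded iffs, simplified]
    show False
      using splits swaps assms(2,3)[unfolded iffs, simplified] by satx
  qed
qed

text \<open>Strong induction on the size of the support \<open>E\<close> of \<open>m\<close>, with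
  \<open>m\<close> general since both reductions change it.\<close>

lemma realizable_T0:
  assumes "n \<le> 6" "E \<subseteq> strand_pairs n" "T0_set E"
    and "\<And>i j. (i, j) \<in> strand_pairs n \<Longrightarrow> even (m i j) \<and> (m i j \<noteq> 0 \<longleftrightarrow> (i, j) \<in> E)"
  shows "realizable n m"
  using assms(2-)
proof (induction "card E" arbitrary: E m rule: less_induct)
  case less
  have fin: "finite E"
    using less.prems(1) finite_strand_pairs finite_subset by blast
  \<comment> \<open>Fewer strands are treated as six, the extra strands occurring in no pair of
    \<open>E\<close>.\<close>
  have "strand_pairs n \<subseteq> strand_pairs 6"
    using assms(1) by (auto simp: strand_pairs_def)
  then have "E \<subseteq> strand_pairs 6"
    using less.prems(1) by blast
  then consider (empty) "E = {}" | (swap) k where "swappable E k"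
    | (split) A where "E \<inter> A \<noteq> {}" "E - A \<noteq> {}" "T0_set (E \<inter> A)" "T0_set (E - A)"
    using T0_set_6_cases[of E] less.prems(2) by blast
  then show ?case
  proof cases
    case empty
    then show ?thesis
      using realizable_cong[of n m "\<lambda>i j. 0"] realizable_zero less.prems(3) by auto
  next
    case split
    have "card (E \<inter> A) < card E" "card (E - A) < card E"
      using fin split by (auto intro!: psubset_card_mono)
    then have "realizable n (\<lambda>i j. if (i, j) \<in> E \<inter> A then m i j else 0)"
      "realizable n (\<lambda>i j. if (i, j) \<in> E - A then m i j else 0)"
      using less.hyps[of "E \<inter> A" "\<lambda>i j. if (i, j) \<in> E \<inter> A then m i j else 0"]
        less.hyps[of "E - A" "\<lambda>i j. if (i, j) \<in> E - A then m i j else 0"] less.prems split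
      by (simp_all add: le_infI1 Diff_subset[THEN subset_trans])
    from realizable_add[OF this] show ?thesis
      by (rule realizable_cong[THEN iffD1, rotated]) (use less.prems(3) in auto)
  next
    case swap
    then have kE: "(k, Suc k) \<in> E"
      by (simp add: swappable_def)
    then have k: "(k, Suc k) \<in> strand_pairs n"
      using less.prems(1) by auto
    with kE have "even (m k (Suc k))" "m k (Suc k) \<noteq> 0"
      using less.prems(3) by auto
    \<comment> \<open>Two of the crossings of \<open>k\<close> and \<open>Suc k\<close> will come
      from the conjugation, the other \<open>2 * c\<close> from
      \<open>realizable_adjacent\<close>.\<close>
    then obtain c where c: "m k (Suc k) = 2 * c + 2"
      by (elim evenE) (metis add.commute mult_Suc_right not0_implies_Suc mult_0_right)
    \<comment> \<open>The value at \<open>(k, Suc k)\<close> is set to 0 by hand: the swap would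
      evaluate \<open>m\<close> at a decreasing pair, where nothing is known about it.\<close>
    let ?m = "\<lambda>i j. if i = k \<and> j = Suc k then 0 else m (adj_swap k i) (adj_swap k j)"
    have "realizable n ?m"
    proof (rule less.hyps[of "swap_pairs E k"])
      show "card (swap_pairs E k) < card E"
        using card_swap_pairs fin swap .
      show "swap_pairs E k \<subseteq> strand_pairs n"
        using swap_pairs_subset less.prems(1) swap .
      show "T0_set (swap_pairs E k)"
        using T0_set_swap_pairs less.prems(2) swap .
      have "even (?m i j) \<and> (?m i j \<noteq> 0 \<longleftrightarrow> (i, j) \<in> swap_pairs E k)"
        if ij: "(i, j) \<in> strand_pairs n" for i j
      proof (cases "i = k \<and> j = Suc k")
        case True
        then show ?thesis
          using less.prems(1) by (auto simp: swap_pairs_def strand_pairs_def)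
      next
        case False
        then have "(adj_swap k i, adj_swap k j) \<in> strand_pairs n"
          using ij k by (auto simp: strand_pairs_def Transposition.transpose_def)
        moreover have "i < j" "(adj_swap k i, adj_swap k j) \<noteq> (k, Suc k)"
          using ij by (auto simp: strand_pairs_def Transposition.transpose_def split: if_splits)
        ultimately show ?thesis
          using False less.prems(3) by (auto simp: swap_pairs_def)
      qed
      then show "even (?m i j) \<and> (?m i j \<noteq> 0 \<longleftrightarrow> (i, j) \<in> swap_pairs E k)"
        if "(i, j) \<in> strand_pairs n" for i j
        using that by blast
    qed
    then have "realizable n (\<lambda>i j. ?m i j + (if i = k \<and> j = Suc k then 2 * c else 0))"
      using realizable_adjacent[OF k] by (rule realizable_add)
    from realizable_conjugate[OF this k] show ?thesis
    proof (rule realizable_cong[THEN iffD1, rotated])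
      fix i j
      assume "(i, j) \<in> strand_pairs n"
      \<comment> \<open>An increasing pair is never swapped onto \<open>(k, Suc k)\<close>, so the
        additional \<open>2 * c\<close> affects no other pair.\<close>
      then have "\<not> (adj_swap k i = k \<and> adj_swap k j = Suc k)"
        by (auto simp: strand_pairs_def Transposition.transpose_def split: if_splits)
      then show "(if i = k \<and> j = Suc k
          then ?m k (Suc k) + (if k = k \<and> Suc k = Suc k then 2 * c else 0) + 2
          else ?m (adj_swap k i) (adj_swap k j)
            + (if adj_swap k i = k \<and> adj_swap k j = Suc k then 2 * c else 0)) = m i j"
        using c by auto
    qed
  qed
qed

section \<open>The matrices of pure diagrams and projections\<close>

lemma elements_mat_ball_iff:
  assumes "M \<in> carrier_mat n n"
  shows "(\<forall>x \<in> elements_mat M. P x) \<longleftrightarrow> (\<forall>i<n. \<forall>j<n. P (M $$ (i, j)))"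
  using assms by (auto simp: elements_mat_def)

lemma T0_mat_iff:
  assumes "M \<in> carrier_mat n n"
  shows "T0_mat M \<longleftrightarrow> (\<forall>i<n. M $$ (i, i) = 0) \<and>
    (\<forall>i j k. i < j \<longrightarrow> j < k \<longrightarrow> k < n \<longrightarrow>
      M $$ (i, j) = 0 \<longrightarrow> M $$ (j, k) = 0 \<longrightarrow> M $$ (i, k) = 0)"
  using assms by (simp add: T0_mat_def)

lemma sym_mat_iff:
  assumes "M \<in> carrier_mat n n"
  shows "sym_mat M \<longleftrightarrow> (\<forall>i<n. \<forall>j<n. M $$ (i, j) = M $$ (j, i))"
  unfolding sym_mat_def mat_eq_iff using assms by auto

lemma crossings_between_T0_pure:
  assumes "pure_projection n w" "i \<in> {1..n}" "j \<in> {1..n}" "k \<in> {1..n}" "i < j" "j < k"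
    and "crossings_between w i j = {}" "crossings_between w j k = {}"
  shows "crossings_between w i k = {}"
  using crossings_between_T0[of w i j k] assms by (simp add: pure_projection_def)

lemma CN_matrix_carrier [simp]: "CN_matrix n w \<in> carrier_mat n n"
  by (simp add: CN_matrix_def)

lemma crossing_matrix_carrier [simp]: "crossing_matrix n b \<in> carrier_mat n n"
  by (simp add: crossing_matrix_def)

lemma CN_matrix_index [simp]:
  assumes "i < n" "j < n"
  shows "CN_matrix n w $$ (i, j) =
    (if i = j then 0 else int (card (crossings_between w (Suc i) (Suc j))))"
  using assms by (simp add: CN_matrix_def)

lemma OU_matrix_index [simp]:
  assumes "i < n" "j < n"
  shows "OU_matrix n b $$ (i, j) =
    (if i = j then 0 else int (card (over_crossings b (Suc i) (Suc j))))"
  using assms by (simp add: OU_matrix_def)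

lemma CN_matrix_pure:
  assumes "pure_projection n w"
  shows "even_mat (CN_matrix n w)" "T0_mat (CN_matrix n w)" "sym_mat (CN_matrix n w)"
proof -
  have "even (card (crossings_between w (Suc i) (Suc j)))" if "i < n" "j < n" "i \<noteq> j" for i j
    using that assms pure_left_right_crossings_commute[of n w "Suc i" "Suc j"]
    by (simp add: card_crossings_between)
  then show "even_mat (CN_matrix n w)"
    by (simp add: even_mat_def elements_mat_ball_iff[OF CN_matrix_carrier])
  have "crossings_between w (Suc i) (Suc k) = {}"
    if "i < j" "j < k" "k < n"
      "crossings_between w (Suc i) (Suc j) = {}" "crossings_between w (Suc j) (Suc k) = {}" for i j k
    using crossings_between_T0_pure[OF assms, of "Suc i" "Suc j" "Suc k"] that by simp
  then show "T0_mat (CN_matrix n w)"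
    unfolding T0_mat_iff[OF CN_matrix_carrier] by simp
  show "sym_mat (CN_matrix n w)"
    by (simp add: sym_mat_iff[OF CN_matrix_carrier] crossings_between_commute)
qed

lemma CN_matrix_surj:
  assumes "n \<le> 6" "M \<in> carrier_mat n n" "nonneg_int_mat M" "even_mat M" "T0_mat M" "sym_mat M"
  obtains w where "pure_projection n w" "CN_matrix n w = M"
proof -
  have nonneg: "0 \<le> M $$ (i, j)" and even: "even (M $$ (i, j))" if "i < n" "j < n" for i j
    using assms that elements_mat_ball_iff[OF assms(2)] by (auto simp: nonneg_int_mat_def even_mat_def)
  have sym: "M $$ (i, j) = M $$ (j, i)" if "i < n" "j < n" for i j
    using assms(6) that by (simp add: sym_mat_iff[OF assms(2)])
  have diag: "M $$ (i, i) = 0" if "i < n" for i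
    using assms(5) that by (simp add: T0_mat_iff[OF assms(2)])
  have T0: "M $$ (i, k) = 0"
    if "i < j" "j < k" "k < n" "M $$ (i, j) = 0" "M $$ (j, k) = 0" for i j k
    using assms(5) that unfolding T0_mat_iff[OF assms(2)] by blast
  \<comment> \<open>Strands are numbered from 1 and matrix indices from 0, hence the shifts.\<close>
  let ?E = "{(i, j) \<in> strand_pairs n. M $$ (i - 1, j - 1) \<noteq> 0}"
  have "realizable n (\<lambda>i j. nat (M $$ (i - 1, j - 1)))"
  proof (rule realizable_T0[OF assms(1)])
    show "?E \<subseteq> strand_pairs n"
      by auto
    show "T0_set ?E"
      unfolding T0_set_def
    proof (intro allI impI)
      fix i j k :: nat
      assume ijk: "i < j" "j < k" "(i, k) \<in> ?E"
      then have "i - 1 < j - 1" "j - 1 < k - 1" "k - 1 < n"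
        by (auto simp: strand_pairs_def)
      from T0[OF this] ijk show "(i, j) \<in> ?E \<or> (j, k) \<in> ?E"
        by (auto simp: strand_pairs_def)
    qed
    fix i j
    assume ij: "(i, j) \<in> strand_pairs n"
    then have "0 \<le> M $$ (i - 1, j - 1)" "even (M $$ (i - 1, j - 1))"
      using nonneg even by (auto simp: strand_pairs_def)
    then show "even (nat (M $$ (i - 1, j - 1))) \<and>
        (nat (M $$ (i - 1, j - 1)) \<noteq> 0 \<longleftrightarrow> (i, j) \<in> ?E)"
      using ij by (auto simp: even_nat_iff)
  qed
  then obtain w where w: "pure_projection n w"
    "\<And>i j. (i, j) \<in> strand_pairs n \<Longrightarrow>
      card (crossings_between w i j) = nat (M $$ (i - 1, j - 1))"
    unfolding realizable_def by blast
  \<comment> \<open>This settles the entries above the diagonal; symmetry and the zero diagonal give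
    the others.\<close>
  have less: "int (card (crossings_between w (Suc i) (Suc j))) = M $$ (i, j)"
    if "i < j" "j < n" for i j
    using w(2)[of "Suc i" "Suc j"] nonneg[of i j] that by (simp add: strand_pairs_def)
  have "CN_matrix n w = M"
  proof (rule eq_matI)
    fix i j
    assume "i < dim_row M" "j < dim_col M"
    then have "i < n" "j < n"
      using assms(2) by auto
    then show "CN_matrix n w $$ (i, j) = M $$ (i, j)"
      using less[of i j] less[of j i] sym[of i j] diag[of i]
        crossings_between_commute[of w "Suc i" "Suc j"]
      by (cases i j rule: linorder_cases) simp_all
  qed (use assms(2) in \<open>auto simp: CN_matrix_def\<close>)
  with w(1) show thesis
    using that by blast
qed

section \<open>From projections to diagrams: OU and crossing matrices\<close>

lemma over_strand_in: "over_strand b t \<in> {left_strand (proj b) t, right_strand (proj b) t}"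
  by (simp add: over_strand_def split: over_info.split)

text \<open>Every crossing of two distinct strands has exactly one of them over.\<close>

lemma OU_matrix_plus_transpose: "OU_matrix n b + transpose_mat (OU_matrix n b) = CN_matrix n (proj b)"
proof (rule eq_matI)
  fix i j
  assume "i < dim_row (CN_matrix n (proj b))" "j < dim_col (CN_matrix n (proj b))"
  then have ij: "i < n" "j < n"
    by (auto simp: CN_matrix_def)
  have "card (crossings_between (proj b) (Suc i) (Suc j)) =
      card (over_crossings b (Suc i) (Suc j)) + card (over_crossings b (Suc j) (Suc i))"
    if "i \<noteq> j"
  proof -
    have "crossings_between (proj b) (Suc i) (Suc j) =
        over_crossings b (Suc i) (Suc j) \<union> over_crossings b (Suc j) (Suc i)"
    proof (rule Set.set_eqI)
      show "t \<in> crossings_between (proj b) (Suc i) (Suc j) \<longleftrightarrow>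
          t \<in> over_crossings b (Suc i) (Suc j) \<union> over_crossings b (Suc j) (Suc i)" for t
        using over_strand_in[of b t]
        by (auto simp: over_crossings_def crossings_between_def doubleton_eq_iff)
    qed
    moreover have "over_crossings b (Suc i) (Suc j) \<inter> over_crossings b (Suc j) (Suc i) = {}"
      using that by (auto simp: over_crossings_def)
    moreover have "finite (over_crossings b x y)" for x y
      by (simp add: over_crossings_def)
    ultimately show ?thesis
      by (simp add: card_Un_disjoint)
  qed
  then show "(OU_matrix n b + transpose_mat (OU_matrix n b)) $$ (i, j) = CN_matrix n (proj b) $$ (i, j)"
    using ij by (simp add: OU_matrix_def CN_matrix_def)
qed (auto simp: OU_matrix_def CN_matrix_def)

text \<open>In a positive diagram the right strand is always over, so the first index of the entry
  becomes the right strand.\<close>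

lemma positive_crossing_matrix_index:
  assumes "positive_diagram b" "i < n" "j < n"
  shows "crossing_matrix n b $$ (i, j) =
    (if i = j then 0 else int (card (left_right_crossings (proj b) (Suc j) (Suc i))))"
proof -
  have pos: "positive_crossing b t" "over_strand b t = right_strand (proj b) t"
    if "t < length (proj b)" for t
    using assms(1) that
    by (auto simp: positive_diagram_def positive_crossing_def over_strand_def proj_def)
  have none: "{t \<in> over_crossings b (Suc i) (Suc j). \<not> positive_crossing b t} = {}"
    using pos by (auto simp: over_crossings_def crossings_between_def)
  have "card {t \<in> over_crossings b (Suc i) (Suc j). \<not> positive_crossing b t} = 0"
    unfolding none by simp
  moreover have "{t \<in> over_crossings b (Suc i) (Suc j). positive_crossing b t} =
      left_right_crossings (proj b) (Suc j) (Suc i)" if "i \<noteq> j"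
    using that pos by (auto simp: over_crossings_def crossings_between_def left_right_crossings_def
        doubleton_eq_iff)
  ultimately show ?thesis
    using assms(2,3) by (simp add: crossing_matrix_def)
qed

text \<open>By purity both directions are equally frequent, so exactly half of the crossings of a
  pair have a given strand over.\<close>

lemma pure_positive_crossing_matrix:
  assumes "pure_diagram n b" "positive_diagram b"
  shows "crossing_matrix n b + crossing_matrix n b = CN_matrix n (proj b)"
proof (rule eq_matI)
  fix i j
  assume "i < dim_row (CN_matrix n (proj b))" "j < dim_col (CN_matrix n (proj b))"
  then have ij: "i < n" "j < n"
    by (auto simp: CN_matrix_def)
  then have "card (left_right_crossings (proj b) (Suc i) (Suc j)) =
      card (left_right_crossings (proj b) (Suc j) (Suc i))"
    using assms(1) by (intro pure_left_right_crossings_commute[of n]) (auto simp: pure_diagram_def)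
  then show "(crossing_matrix n b + crossing_matrix n b) $$ (i, j) = CN_matrix n (proj b) $$ (i, j)"
    using ij positive_crossing_matrix_index[OF assms(2) ij] crossing_matrix_carrier[of n b]
    by (simp add: card_crossings_between del: crossing_matrix_carrier)
qed (auto simp: crossing_matrix_def CN_matrix_def)

lemma diagram_over_strand:
  assumes "\<And>t. t < length w \<Longrightarrow> f t \<in> {left_strand w t, right_strand w t}"
  obtains b where "proj b = w" "\<And>t. t < length w \<Longrightarrow> over_strand b t = f t"
proof
  let ?b = "map (\<lambda>t. (w ! t, if f t = left_strand w t then Left_Over else Right_Over)) [0..<length w]"
  show proj: "proj ?b = w"
    by (simp add: proj_def map_nth comp_def)
  show "over_strand ?b t = f t" if "t < length w" for t
    using that assms[OF that] unfolding over_strand_def proj by auto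
qed

text \<open>For \<open>i < j\<close>, choose \<open>M $$ (i, j)\<close> of the crossings of the two
  strands and let the left-named strand \<open>i\<close> pass over there; the hypothesis leaves
  \<open>M $$ (j, i)\<close> crossings for the other strand.\<close>

lemma OU_matrix_surj:
  assumes M: "M \<in> carrier_mat n n" "nonneg_int_mat M"
    and sum: "CN_matrix n w = M + transpose_mat M"
  obtains b where "proj b = w" "OU_matrix n b = M"
proof -
  have nonneg: "0 \<le> M $$ (i, j)" if "i < n" "j < n" for i j
    using M that elements_mat_ball_iff[OF M(1)] by (auto simp: nonneg_int_mat_def)
  have card: "(if i = j then 0 else int (card (crossings_between w (Suc i) (Suc j)))) =
      M $$ (i, j) + M $$ (j, i)" if "i < n" "j < n" for i j
    using arg_cong[OF sum, of "\<lambda>A. A $$ (i, j)"] that M(1) by simp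
  have "\<exists>S \<subseteq> crossings_between w (Suc i) (Suc j). int (card S) = M $$ (i, j)"
    if "i < j" "j < n" for i j
  proof -
    have "nat (M $$ (i, j)) \<le> card (crossings_between w (Suc i) (Suc j))"
      using card[of i j] nonneg[of j i] that by simp
    then obtain S where "S \<subseteq> crossings_between w (Suc i) (Suc j)" "card S = nat (M $$ (i, j))"
      by (meson obtain_subset_with_card_n)
    then show ?thesis
      using nonneg[of i j] that by auto
  qed
  then obtain S where S: "\<And>i j. i < j \<Longrightarrow> j < n \<Longrightarrow> S i j \<subseteq> crossings_between w (Suc i) (Suc j)"
    "\<And>i j. i < j \<Longrightarrow> j < n \<Longrightarrow> int (card (S i j)) = M $$ (i, j)"
    by metis
  \<comment> \<open>The smaller and larger name at crossing \<open>t\<close> recover which chosen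
    set \<open>S i j\<close> concerns it.\<close>
  define lo where "lo t = min (left_strand w t) (right_strand w t)" for t
  define hi where "hi t = max (left_strand w t) (right_strand w t)" for t
  have "(if t \<in> S (lo t - 1) (hi t - 1) then lo t else hi t) \<in> {left_strand w t, right_strand w t}" for t
    by (auto simp: lo_def hi_def min_def max_def)
  then obtain b where b: "proj b = w"
    "\<And>t. t < length w \<Longrightarrow> over_strand b t = (if t \<in> S (lo t - 1) (hi t - 1) then lo t else hi t)"
    using diagram_over_strand[of w "\<lambda>t. if t \<in> S (lo t - 1) (hi t - 1) then lo t else hi t"] by blast
  have over: "int (card (over_crossings b (Suc i) (Suc j))) = M $$ (i, j) \<and>
      int (card (over_crossings b (Suc j) (Suc i))) = M $$ (j, i)" if ij: "i < j" "j < n" for i j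
  proof -
    have "t < length w \<and> lo t = Suc i \<and> hi t = Suc j"
      if "t \<in> crossings_between w (Suc i) (Suc j)" for t
      using that ij by (auto simp: crossings_between_def lo_def hi_def doubleton_eq_iff)
    then have "over_strand b t = (if t \<in> S i j then Suc i else Suc j)"
      if "t \<in> crossings_between w (Suc i) (Suc j)" for t
      using that b(2)[of t] by simp
    then have "over_crossings b (Suc i) (Suc j) = S i j"
      "over_crossings b (Suc j) (Suc i) = crossings_between w (Suc i) (Suc j) - S i j"
      using S(1)[OF ij] ij b(1) crossings_between_commute[of w "Suc i" "Suc j"]
      by (auto simp: over_crossings_def split: if_splits)
    then show ?thesis
      using S[OF ij] card[of i j] ij
        card_Diff_subset[of "S i j" "crossings_between w (Suc i) (Suc j)"]
        card_mono[of "crossings_between w (Suc i) (Suc j)" "S i j"]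
        finite_subset[of "S i j" "crossings_between w (Suc i) (Suc j)"]
      by (simp add: of_nat_diff)
  qed
  have "OU_matrix n b = M"
  proof (rule eq_matI)
    fix i j
    assume "i < dim_row M" "j < dim_col M"
    then have ij: "i < n" "j < n"
      using M(1) by auto
    then show "OU_matrix n b $$ (i, j) = M $$ (i, j)"
      using over[of i j] over[of j i] card[of i i]
      by (cases i j rule: linorder_cases) simp_all
  qed (use M(1) in \<open>auto simp: OU_matrix_def\<close>)
  with b(1) show thesis
    using that by blast
qed

lemma pure_diagram_iff: "pure_diagram n b \<longleftrightarrow> pure_projection n (proj b)"
  by (auto simp: pure_diagram_def braid_diagram_def pure_projection_def)

theorem theorem1:
  fixes n :: nat
  assumes "0 < n" and "n \<le> 6"
  shows "(\<forall>M \<in> carrier_mat n n.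
            (\<exists>b. pure_diagram n b \<and> positive_diagram b \<and> M = crossing_matrix n b)
              \<longleftrightarrow> nonneg_int_mat M \<and> T0_mat M \<and> sym_mat M)
       \<and> (\<forall>M \<in> carrier_mat n n. nonneg_int_mat M \<longrightarrow>
            ((\<exists>b. pure_diagram n b \<and> M = OU_matrix n b)
              \<longleftrightarrow> even_mat (M + transpose_mat M) \<and> T0_mat (M + transpose_mat M)))
       \<and> (\<forall>M \<in> carrier_mat n n. nonneg_int_mat M \<longrightarrow>
            ((\<exists>B. pure_projection n B \<and> M = CN_matrix n B)
              \<longleftrightarrow> even_mat M \<and> T0_mat M \<and> sym_mat M))"
proof (intro conjI ballI impI)
  fix M :: "int mat"
  assume M: "M \<in> carrier_mat n n"
  have MM: "M + M \<in> carrier_mat n n"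
    using M by simp
  \<comment> \<open>Doubling reduces the crossing matrix statement to CN matrices, evenness being
    automatic.\<close>
  have double: "T0_mat (M + M) \<longleftrightarrow> T0_mat M" "sym_mat (M + M) \<longleftrightarrow> sym_mat M" "even_mat (M + M)"
    "nonneg_int_mat (M + M) \<longleftrightarrow> nonneg_int_mat M"
    using M by (auto simp: T0_mat_iff[OF M] T0_mat_iff[OF MM] sym_mat_iff[OF M] sym_mat_iff[OF MM]
        even_mat_def nonneg_int_mat_def elements_mat_ball_iff[OF M] elements_mat_ball_iff[OF MM])
  show "(\<exists>b. pure_diagram n b \<and> positive_diagram b \<and> M = crossing_matrix n b)
      \<longleftrightarrow> nonneg_int_mat M \<and> T0_mat M \<and> sym_mat M"
  proof
    assume "\<exists>b. pure_diagram n b \<and> positive_diagram b \<and> M = crossing_matrix n b"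
    then obtain b where b: "pure_diagram n b" "positive_diagram b" "M = crossing_matrix n b"
      by blast
    have "nonneg_int_mat M"
      by (simp add: nonneg_int_mat_def b(3) elements_mat_ball_iff[OF crossing_matrix_carrier]
          positive_crossing_matrix_index[OF b(2)])
    moreover have "M + M = CN_matrix n (proj b)"
      using pure_positive_crossing_matrix b by simp
    ultimately show "nonneg_int_mat M \<and> T0_mat M \<and> sym_mat M"
      using CN_matrix_pure[of n "proj b"] b(1) double by (simp add: pure_diagram_iff)
  next
    assume "nonneg_int_mat M \<and> T0_mat M \<and> sym_mat M"
    then obtain w where w: "pure_projection n w" "CN_matrix n w = M + M"
      using CN_matrix_surj[OF assms(2) MM] double by blast
    \<comment> \<open>Every crossing is made positive; its doubled crossing matrix is then
      \<open>M + M\<close>, and halving entrywise gives \<open>M\<close>.\<close>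
    let ?b = "map (\<lambda>k. (k, Right_Over)) w"
    have proj: "proj ?b = w"
      by (simp add: proj_def comp_def)
    have b: "pure_diagram n ?b" "positive_diagram ?b"
      using w(1) by (auto simp: pure_diagram_iff proj positive_diagram_def positive_crossing_def)
    have C: "crossing_matrix n ?b + crossing_matrix n ?b = M + M"
      using pure_positive_crossing_matrix[OF b] w(2) proj by simp
    have "M = crossing_matrix n ?b"
    proof (rule eq_matI)
      fix i j
      assume "i < dim_row (crossing_matrix n ?b)" "j < dim_col (crossing_matrix n ?b)"
      then show "M $$ (i, j) = crossing_matrix n ?b $$ (i, j)"
        using arg_cong[OF C, of "\<lambda>A. A $$ (i, j)"] M crossing_matrix_carrier[of n ?b] by auto
    qed (use M in \<open>auto simp: crossing_matrix_def\<close>)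
    with b show "\<exists>b. pure_diagram n b \<and> positive_diagram b \<and> M = crossing_matrix n b"
      by blast
  qed
next
  fix M :: "int mat"
  assume M: "M \<in> carrier_mat n n" and nonneg: "nonneg_int_mat M"
  have MT: "M + transpose_mat M \<in> carrier_mat n n"
    using M by simp
  show "(\<exists>b. pure_diagram n b \<and> M = OU_matrix n b)
      \<longleftrightarrow> even_mat (M + transpose_mat M) \<and> T0_mat (M + transpose_mat M)"
  proof
    assume "\<exists>b. pure_diagram n b \<and> M = OU_matrix n b"
    then show "even_mat (M + transpose_mat M) \<and> T0_mat (M + transpose_mat M)"
      using CN_matrix_pure by (auto simp: OU_matrix_plus_transpose pure_diagram_iff)
  next
    assume "even_mat (M + transpose_mat M) \<and> T0_mat (M + transpose_mat M)"
    moreover have "sym_mat (M + transpose_mat M)"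
      using M by (simp add: sym_mat_iff[OF MT])
    moreover have "nonneg_int_mat (M + transpose_mat M)"
      using M nonneg by (auto simp: nonneg_int_mat_def elements_mat_ball_iff[OF M]
          elements_mat_ball_iff[OF MT])
    ultimately obtain w where "pure_projection n w" "CN_matrix n w = M + transpose_mat M"
      using CN_matrix_surj[OF assms(2) MT] by blast
    then show "\<exists>b. pure_diagram n b \<and> M = OU_matrix n b"
      using OU_matrix_surj[OF M nonneg] by (metis pure_diagram_iff)
  qed
next
  fix M :: "int mat"
  assume "M \<in> carrier_mat n n" "nonneg_int_mat M"
  then show "(\<exists>B. pure_projection n B \<and> M = CN_matrix n B)
      \<longleftrightarrow> even_mat M \<and> T0_mat M \<and> sym_mat M"
    using CN_matrix_pure CN_matrix_surj[OF assms(2)] by metis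
qed

end
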